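(* Let $p$ be an odd prime, let $\mathbb{F}=GF(p)$, and let $c:=1-\frac{1}{18\log p}<1$. For $A\subseteq\mathbb{F}^n$ progression-free, we have $|A|=O(p^{cn})$; that is, there is a constant $K>0$ (which may depend on $p$ but not on $n$ or $A$) such that for every positive integer $n$ and every progression-free subset $A\subseteq \mathbb{F}^n$ we have $|A|\leq K\,p^{cn}$.
   Context: A subset $A$ of an abelian group $G$ is called progression-free if there are no distinct $a,b,c\in A$ (three pairwise distinct elements) for which $a+b=2c$. Here $\mathbb{F}^n$ is regarded as an additive group (isomorphic to $\mathbb{Z}_p^n$). $\log$ denotes the natural logarithm. The prime $p$ is fixed, and the $O(\cdot)$ is as $n\to\infty$. *)

theory Defs
  imports
    Complex_Main
    "HOL-Algebra.Product_Groups"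
    "HOL-Number_Theory.Residues"
begin

(* The group operation is written multiplicatively, so "c [^] 2" is the double 2c of c. *)
definition progression_free :: "('a, 'b) monoid_scheme \<Rightarrow> 'a set \<Rightarrow> bool" where
  "progression_free G A \<longleftrightarrow>
     A \<subseteq> carrier G \<and>
     \<not> (\<exists>a\<in>A. \<exists>b\<in>A. \<exists>c\<in>A.
          a \<noteq> b \<and> a \<noteq> c \<and> b \<noteq> c \<and> a \<otimes>\<^bsub>G\<^esub> b = c [^]\<^bsub>G\<^esub> (2::nat))"

(* The additive group of GF(p)^n.  The field GF(p) is the library ring of residues {0..p-1};
   vectors are the extensional functions on {..<n}, added coordinatewise. *)
definition prime_field_vectors :: "nat \<Rightarrow> nat \<Rightarrow> (nat \<Rightarrow> int) monoid" where
  "prime_field_vectors p n = product_group {..<n} (\<lambda>_. add_monoid (residue_ring (int p)))"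

lemma comm_group_prime_field_vectors:
  assumes "prime p"
  shows "comm_group (prime_field_vectors p n)"
proof -
  interpret residues_prime p "residue_ring (int p)"
    using assms by unfold_locales simp_all
  have grp: "group (prime_field_vectors p n)"
    unfolding prime_field_vectors_def by (intro product_group a_group)
  show ?thesis
  proof (rule group.group_comm_groupI[OF grp])
    fix x y
    assume "x \<in> carrier (prime_field_vectors p n)" "y \<in> carrier (prime_field_vectors p n)"
    then show "x \<otimes>\<^bsub>prime_field_vectors p n\<^esub> y = y \<otimes>\<^bsub>prime_field_vectors p n\<^esub> x"
      by (auto simp: prime_field_vectors_def residue_ring_def add.commute intro!: restrict_ext)
  qed
qed

lemma card_prime_field_vectors:
  "card (carrier (prime_field_vectors p n)) = p ^ n"
  by (simp add: prime_field_vectors_def residue_ring_def card_PiE)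

end

theory Submission
  imports Defs
begin

text \<open>
  Tao's slice rank argument. By Fermat's little theorem the polynomial
  \<open>\<Prod>i<n. 1 - (x\<^sub>i + y\<^sub>i - 2 z\<^sub>i) ^ (p - 1)\<close> restricted to a progression-free set is the indicator of
  the diagonal \<open>x = y = z\<close>, whose slice rank is the size of the set. On the other hand, expanding the
  polynomial and sorting its monomials by a group of variables of low degree writes it with three
  times as many slices as there are exponent vectors in \<open>{0..p - 1}\<^sup>n\<close> of weight at most
  \<open>n (p - 1) / 3\<close>, and a Chernoff bound shows that there are at most \<open>p\<^sup>n exp (- n / 18)\<close> of them. Linear
  algebra over \<open>GF(p)\<close> is replaced throughout by the pigeonhole principle on the finitely many residue
  vectors.
\<close>

section \<open>A Gaussian bound for the hyperbolic cosine\<close>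

text \<open>The two power series compare term by term, because
  \<open>2 ^ n * fact n \<le> fact (2 * n)\<close>. The bound later controls symmetrised exponential
  weights.\<close>

lemma cosh_le_exp_half_square: "cosh x \<le> exp (x\<^sup>2 / 2)" for x :: real
proof -
  have "(\<lambda>n. if even n then x ^ n /\<^sub>R fact n else 0) sums cosh x"
    by (rule cosh_converges)
  hence "(\<lambda>n. (if even (2 * n) then x ^ (2 * n) /\<^sub>R fact (2 * n) else 0)) sums cosh x"
    by (subst sums_mono_reindex[where g = "\<lambda>n. 2 * n"]) (auto simp: strict_mono_def)
  hence 1: "(\<lambda>n. x ^ (2 * n) / fact (2 * n)) sums cosh x"
    by (simp add: field_simps)
  have 2: "(\<lambda>n. (x\<^sup>2 / 2) ^ n / fact n) sums exp (x\<^sup>2 / 2)"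
    using exp_converges[of "x\<^sup>2 / 2"] by (simp add: field_simps)
  have fact_ge: "2 ^ n * fact n \<le> (fact (2 * n) :: real)" for n
  proof (induction n)
    case (Suc n)
    have "2 ^ Suc n * fact (Suc n) = (2 * real n + 2) * (2 ^ n * fact n)"
      by (simp add: algebra_simps)
    also have "\<dots> \<le> (2 * real n + 2) * ((2 * real n + 1) * fact (2 * n))"
    proof (intro mult_left_mono)
      have "fact (2 * n) \<le> (2 * real n + 1) * (fact (2 * n) :: real)"
        by (simp add: algebra_simps)
      with Suc.IH show "2 ^ n * fact n \<le> (2 * real n + 1) * fact (2 * n)"
        by (rule order_trans)
    qed auto
    also have "\<dots> = fact (2 * Suc n)"
      by (simp add: algebra_simps)
    finally show ?case .
  qed auto
  have "x ^ (2 * n) / fact (2 * n) \<le> (x\<^sup>2 / 2) ^ n / fact n" for n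
  proof -
    have "x ^ (2 * n) / fact (2 * n) \<le> x ^ (2 * n) / (2 ^ n * fact n)"
      by (intro divide_left_mono fact_ge) auto
    thus ?thesis by (simp add: power_mult power_divide)
  qed
  from sums_le[OF this 1 2] show ?thesis .
qed

section \<open>Linear algebra modulo p by counting\<close>

text \<open>There are \<open>p ^ card A\<close> residue vectors but only \<open>p ^ card L\<close>
  tuples of values of the linear forms, so two distinct vectors share all values; their difference
  is the solution.\<close>

lemma nontrivial_solution_mod:
  fixes p :: nat and \<phi> :: "'l \<Rightarrow> 'a \<Rightarrow> int"
  assumes p: "p > 1" and fin: "finite A" "finite L" and card: "card L < card A"
  obtains w a where "a \<in> A" "\<not> [w a = 0] (mod int p)"
    "\<And>l. l \<in> L \<Longrightarrow> [(\<Sum>a\<in>A. \<phi> l a * w a) = 0] (mod int p)"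
proof -
  define W where "W = A \<rightarrow>\<^sub>E {0..<int p}"
  define \<Phi> where "\<Phi> w = (\<lambda>l\<in>L. (\<Sum>a\<in>A. \<phi> l a * w a) mod int p)" for w
  have "card (L \<rightarrow>\<^sub>E {0..<int p}) < card W"
    using p card fin by (simp add: W_def card_PiE)
  moreover have "\<Phi> ` W \<subseteq> L \<rightarrow>\<^sub>E {0..<int p}"
    using p by (auto simp: \<Phi>_def)
  ultimately have "\<not> inj_on \<Phi> W"
    using card_inj_on_le[of \<Phi> W "L \<rightarrow>\<^sub>E {0..<int p}"] fin by (auto simp: finite_PiE)
  then obtain u v where uv: "u \<in> W" "v \<in> W" "\<Phi> u = \<Phi> v" "u \<noteq> v"
    by (auto simp: inj_on_def)
  then obtain a where a: "a \<in> A" "u a \<noteq> v a"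
    unfolding W_def by (meson PiE_ext)
  show thesis
  proof (rule that[of a "\<lambda>a. u a - v a"])
    \<comment> \<open>Both entries are representatives in \<open>{0..<int p}\<close>, where distinct
      means incongruent.\<close>
    show "\<not> [u a - v a = 0] (mod int p)"
    proof
      assume "[u a - v a = 0] (mod int p)"
      hence "u a mod int p = v a mod int p"
        by (simp add: cong_diff_iff_cong_0 cong_def[symmetric])
      moreover have "u a \<in> {0..<int p}" "v a \<in> {0..<int p}"
        using uv a by (auto simp: W_def)
      ultimately show False using a by simp
    qed
  next
    fix l assume "l \<in> L"
    hence "[(\<Sum>a\<in>A. \<phi> l a * u a) = (\<Sum>a\<in>A. \<phi> l a * v a)] (mod int p)"
      using fun_cong[OF uv(3), of l] by (simp add: \<Phi>_def cong_def)
    thus "[(\<Sum>a\<in>A. \<phi> l a * (u a - v a)) = 0] (mod int p)"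
      by (simp add: algebra_simps sum_subtractf cong_diff_iff_cong_0)
  qed (use a in auto)
qed

text \<open>
  A solution of maximal support: a nontrivial solution vanishing on that support could be added to
  it to enlarge the support.
\<close>
lemma orthogonal_vector_large_support:
  fixes p :: nat and h :: "'k \<Rightarrow> 'a \<Rightarrow> int"
  assumes p: "p > 1" and fin: "finite A" "finite K"
  obtains v where "\<And>k. k \<in> K \<Longrightarrow> [(\<Sum>z\<in>A. h k z * v z) = 0] (mod int p)"
    "card A \<le> card {z\<in>A. \<not> [v z = 0] (mod int p)} + card K"
proof -
  define V where "V = {v. \<forall>k\<in>K. [(\<Sum>z\<in>A. h k z * v z) = 0] (mod int p)}"
  define supp where "supp v = {z\<in>A. \<not> [v z = 0] (mod int p)}" for v
  have "(\<lambda>_. 0) \<in> V" by (simp add: V_def)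
  moreover have "\<forall>v. v \<in> V \<longrightarrow> card (supp v) < Suc (card A)"
    using fin by (auto simp: supp_def less_Suc_eq_le intro!: card_mono)
  ultimately obtain v where v: "v \<in> V" "\<And>u. u \<in> V \<Longrightarrow> card (supp u) \<le> card (supp v)"
    using ex_has_greatest_nat[of "\<lambda>v. v \<in> V" _ "\<lambda>v. card (supp v)"] by blast
  have sub: "supp v \<subseteq> A" and finS: "finite (supp v)"
    using fin by (auto simp: supp_def)
  have "card A \<le> card (supp v) + card K"
  proof (rule ccontr)
    assume "\<not> ?thesis"
    hence less: "card (K <+> supp v) < card A"
      using fin finS by (simp add: card_Plus)
    \<comment> \<open>The \<open>Inr\<close> rows are unit vectors: solving them forces
      \<open>w\<close> to vanish modulo p on the support of \<open>v\<close>, while the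
      \<open>Inl\<close> rows keep \<open>w\<close> orthogonal to every \<open>h k\<close>.\<close>
    define \<phi> where "\<phi> = case_sum h (\<lambda>s z. if z = s then 1 else 0 :: int)"
    obtain w a where a: "a \<in> A" "\<not> [w a = 0] (mod int p)" and
      w: "\<And>l. l \<in> K <+> supp v \<Longrightarrow> [(\<Sum>z\<in>A. \<phi> l z * w z) = 0] (mod int p)"
      using nontrivial_solution_mod[OF p fin(1) finite_Plus[OF fin(2) finS] less, of \<phi>] by blast
    have w0: "[w s = 0] (mod int p)" if "s \<in> supp v" for s
    proof -
      have "(\<Sum>z\<in>A. \<phi> (Inr s) z * w z) = (\<Sum>z\<in>A. if z = s then w z else 0)"
        by (intro sum.cong) (auto simp: \<phi>_def)
      also have "\<dots> = w s"
        using that sub fin by (subst sum.delta) auto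
      finally show ?thesis using w[of "Inr s"] that by auto
    qed
    define u where "u z = v z + w z" for z
    have "u \<in> V"
      unfolding V_def
    proof safe
      fix k assume k: "k \<in> K"
      have "[(\<Sum>z\<in>A. h k z * v z) + (\<Sum>z\<in>A. h k z * w z) = 0 + 0] (mod int p)"
        using w[of "Inl k"] v(1) k by (intro cong_add) (auto simp: V_def \<phi>_def)
      thus "[(\<Sum>z\<in>A. h k z * u z) = 0] (mod int p)"
        by (simp add: u_def distrib_left sum.distrib)
    qed
    have "[u s = v s + 0] (mod int p)" if "s \<in> supp v" for s
      unfolding u_def using w0[OF that] by (intro cong_add) auto
    hence "[v s = u s] (mod int p)" if "s \<in> supp v" for s
      using that by (simp add: cong_sym)
    hence "supp v \<subseteq> supp u"
      unfolding supp_def using cong_trans by blast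
    moreover have "a \<notin> supp v" using w0 a by auto
    moreover have "a \<in> supp u"
    proof -
      have "[v a = 0] (mod int p)" using \<open>a \<notin> supp v\<close> a by (auto simp: supp_def)
      hence "[u a = 0 + w a] (mod int p)" unfolding u_def by (intro cong_add) auto
      hence "[w a = u a] (mod int p)" by (simp add: cong_sym)
      thus ?thesis using a unfolding supp_def using cong_trans by blast
    qed
    ultimately have "supp v \<subset> supp u" by auto
    moreover have "finite (supp u)" using fin by (auto simp: supp_def)
    ultimately have "card (supp v) < card (supp u)" by (intro psubset_card_mono)
    with v(2)[OF \<open>u \<in> V\<close>] show False by simp
  qed
  thus thesis using that[of v] v(1) by (auto simp: V_def supp_def)
qed

section \<open>Slice rank of the diagonal tensor\<close>

text \<open>Contract the variable \<open>z\<close> with a vector \<open>v\<close> orthogonal to all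
  \<open>h k\<close>. The third group of slices vanishes and the tensor becomes the diagonal matrix
  of \<open>v\<close>, whose rank is the size of the support of \<open>v\<close>, at least
  \<open>card A - card K\<close>. The other two groups write this matrix with
  \<open>card I + card J\<close> terms of rank at most one.\<close>

lemma slice_rank_diagonal:
  fixes p :: nat and f :: "'i \<Rightarrow> 'a \<Rightarrow> int" and g :: "'j \<Rightarrow> 'a \<Rightarrow> int" and h :: "'k \<Rightarrow> 'a \<Rightarrow> int"
  assumes p: "prime p" and fin: "finite A" "finite I" "finite J" "finite K"
    and diag: "\<And>x y z. x \<in> A \<Longrightarrow> y \<in> A \<Longrightarrow> z \<in> A \<Longrightarrow>
      [(\<Sum>i\<in>I. f i x * F i y z) + (\<Sum>j\<in>J. g j y * G j x z) + (\<Sum>k\<in>K. h k z * H k x y)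
        = (if x = y \<and> y = z then 1 else 0)] (mod int p)"
  shows "card A \<le> card I + card J + card K"
proof -
  have p1: "p > 1" using p by (rule prime_gt_1_nat)
  obtain v where v: "\<And>k. k \<in> K \<Longrightarrow> [(\<Sum>z\<in>A. h k z * v z) = 0] (mod int p)"
    and v_card: "card A \<le> card {z\<in>A. \<not> [v z = 0] (mod int p)} + card K"
    using orthogonal_vector_large_support[OF p1 fin(1,4)] by blast
  define S where "S = {z\<in>A. \<not> [v z = 0] (mod int p)}"
  have S: "S \<subseteq> A" "finite S" using fin by (auto simp: S_def)
  define F' where "F' i y = (\<Sum>z\<in>A. F i y z * v z)" for i y
  define G' where "G' j x = (\<Sum>z\<in>A. G j x z * v z)" for j x
  have mat: "[(\<Sum>i\<in>I. f i x * F' i y) + (\<Sum>j\<in>J. g j y * G' j x) = (if x = y then v x else 0)] (mod int p)"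
    if xy: "x \<in> A" "y \<in> A" for x y
  proof -
    have "[(\<Sum>z\<in>A. ((\<Sum>i\<in>I. f i x * F i y z) + (\<Sum>j\<in>J. g j y * G j x z) + (\<Sum>k\<in>K. h k z * H k x y)) * v z)
        = (\<Sum>z\<in>A. (if x = y \<and> y = z then 1 else 0) * v z)] (mod int p)"
      using xy by (intro cong_sum cong_mult diag) auto
    also have "(\<Sum>z\<in>A. (if x = y \<and> y = z then 1 else 0) * v z) = (\<Sum>z\<in>A. if z = x then (if x = y then v x else 0) else 0)"
      by (intro sum.cong) auto
    also have "\<dots> = (if x = y then v x else 0)"
      using fin xy by (subst sum.delta) auto
    also have "(\<Sum>z\<in>A. ((\<Sum>i\<in>I. f i x * F i y z) + (\<Sum>j\<in>J. g j y * G j x z) + (\<Sum>k\<in>K. h k z * H k x y)) * v z)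
      = (\<Sum>i\<in>I. f i x * F' i y) + (\<Sum>j\<in>J. g j y * G' j x) + (\<Sum>k\<in>K. H k x y * (\<Sum>z\<in>A. h k z * v z))"
      unfolding F'_def G'_def sum_distrib_left distrib_right sum.distrib sum_distrib_right
      by (intro arg_cong2[of _ _ _ _ "(+)"]; subst sum.swap) (simp_all add: mult_ac)
    finally have *: "[(\<Sum>i\<in>I. f i x * F' i y) + (\<Sum>j\<in>J. g j y * G' j x)
         + (\<Sum>k\<in>K. H k x y * (\<Sum>z\<in>A. h k z * v z)) = (if x = y then v x else 0)] (mod int p)" .
    have "[(\<Sum>k\<in>K. H k x y * (\<Sum>z\<in>A. h k z * v z)) = (\<Sum>k\<in>K. H k x y * 0)] (mod int p)"
      by (intro cong_sum cong_mult v) auto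
    hence "[(\<Sum>i\<in>I. f i x * F' i y) + (\<Sum>j\<in>J. g j y * G' j x)
         + (\<Sum>k\<in>K. H k x y * (\<Sum>z\<in>A. h k z * v z))
       = (\<Sum>i\<in>I. f i x * F' i y) + (\<Sum>j\<in>J. g j y * G' j x) + 0] (mod int p)"
      by (intro cong_add) auto
    from cong_trans[OF cong_sym[OF this] *] show ?thesis by simp
  qed
  have "card S \<le> card (I <+> J)"
  proof (rule ccontr)
    assume "\<not> ?thesis"
    hence less: "card (I <+> J) < card S" by simp
    \<comment> \<open>A vector \<open>u\<close> on \<open>S\<close> killed by all the factors in
      \<open>y\<close>, namely \<open>F' i\<close> and \<open>g j\<close>, is killed by the whole
      matrix; but row \<open>a\<close> of the diagonal matrix sends it to
      \<open>v a * u a\<close>.\<close>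
    define \<phi> where "\<phi> = case_sum F' g"
    obtain u a where a: "a \<in> S" "\<not> [u a = 0] (mod int p)" and
      u: "\<And>l. l \<in> I <+> J \<Longrightarrow> [(\<Sum>y\<in>S. \<phi> l y * u y) = 0] (mod int p)"
      using nontrivial_solution_mod[OF p1 S(2) finite_Plus[OF fin(2,3)] less, of \<phi>] by blast
    have "[(\<Sum>y\<in>S. ((\<Sum>i\<in>I. f i a * F' i y) + (\<Sum>j\<in>J. g j y * G' j a)) * u y)
        = (\<Sum>y\<in>S. (if a = y then v a else 0) * u y)] (mod int p)"
      using S a by (intro cong_sum cong_mult mat) auto
    also have "(\<Sum>y\<in>S. (if a = y then v a else 0) * u y) = (\<Sum>y\<in>S. if y = a then v a * u a else 0)"
      by (intro sum.cong) auto
    also have "\<dots> = v a * u a"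
      using S a by (subst sum.delta) auto
    also have "(\<Sum>y\<in>S. ((\<Sum>i\<in>I. f i a * F' i y) + (\<Sum>j\<in>J. g j y * G' j a)) * u y)
      = (\<Sum>i\<in>I. f i a * (\<Sum>y\<in>S. F' i y * u y)) + (\<Sum>j\<in>J. G' j a * (\<Sum>y\<in>S. g j y * u y))"
      unfolding sum_distrib_left distrib_right sum.distrib sum_distrib_right
      by (intro arg_cong2[of _ _ _ _ "(+)"]; subst sum.swap) (simp_all add: mult_ac)
    finally have *: "[\<dots> = v a * u a] (mod int p)" .
    have "[(\<Sum>i\<in>I. f i a * (\<Sum>y\<in>S. F' i y * u y)) + (\<Sum>j\<in>J. G' j a * (\<Sum>y\<in>S. g j y * u y))
       = (\<Sum>i\<in>I. f i a * 0) + (\<Sum>j\<in>J. G' j a * 0)] (mod int p)"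
      using u[of "Inl _"] u[of "Inr _"] by (intro cong_add cong_sum cong_mult) (auto simp: \<phi>_def)
    hence "[v a * u a = 0] (mod int p)" using * by (simp add: cong_def)
    hence "int p dvd v a * u a" by (simp add: cong_0_iff)
    \<comment> \<open>Primality enters here: a product of two nonzero residues is nonzero, and
      \<open>v a\<close> is nonzero because \<open>a\<close> lies in \<open>S\<close>.\<close>
    hence "int p dvd v a \<or> int p dvd u a" using p by (simp add: prime_dvd_mult_iff)
    thus False using a by (auto simp: S_def cong_0_iff)
  qed
  thus ?thesis using v_card fin by (simp add: S_def card_Plus)
qed

section \<open>Counting exponent vectors of low degree\<close>

text \<open>Each element stands for a monomial in one group of \<open>n\<close> variables. The
  cutoff is a third of the total degree \<open>n * m\<close>, cleared of denominators.\<close>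

definition low_degree_exponents :: "nat \<Rightarrow> nat \<Rightarrow> (nat \<Rightarrow> nat) set" where
  "low_degree_exponents n m = {a \<in> {..<n} \<rightarrow>\<^sub>E {..m}. 3 * (\<Sum>i<n. a i) \<le> n * m}"

lemma finite_low_degree_exponents: "finite (low_degree_exponents n m)"
proof -
  have "finite ({..<n} \<rightarrow>\<^sub>E {..m})" by (intro finite_PiE) auto
  thus ?thesis by (simp add: low_degree_exponents_def)
qed

text \<open>
  Chernoff's method with the exponential weight \<open>exp (t (m / 3 - a\<^sub>i))\<close>; the choice
  \<open>t = 2 / (3 m)\<close> minimises the resulting exponent \<open>- t m / 6 + t\<^sup>2 m\<^sup>2 / 8\<close>.
\<close>
lemma card_low_degree_exponents:
  assumes "m > 0"
  shows "real (card (low_degree_exponents n m)) \<le> (real (m + 1) * exp (- 1 / 18)) ^ n"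
proof -
  define t where "t = 2 / (3 * real m)"
  have t: "t > 0" "t * real m = 2 / 3" using assms by (auto simp: t_def)
  \<comment> \<open>The weight is centred at the mean \<open>m / 2\<close> of \<open>{0..m}\<close>
    so that the reflection \<open>j \<mapsto> m - j\<close> turns its sum into a sum of cosh
    values.\<close>
  define E where "E j = exp (t * (real m / 2 - real j))" for j :: nat
  have "(\<Sum>j\<le>m. E j) = (\<Sum>j\<le>m. E (m - j))"
    by (rule sum.reindex_bij_witness[of _ "\<lambda>j. m - j" "\<lambda>j. m - j"]) auto
  hence "(\<Sum>j\<le>m. E j) = (\<Sum>j\<le>m. (E j + E (m - j)) / 2)"
    by (simp add: sum.distrib flip: sum_divide_distrib)
  also have "\<dots> = (\<Sum>j\<le>m. cosh (t * (real m / 2 - real j)))"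
    by (intro sum.cong) (auto simp: E_def cosh_def of_nat_diff algebra_simps)
  \<comment> \<open>The argument of cosh is at most \<open>t * m / 2 = 1 / 3\<close> in absolute
    value, and half its square is at most 1/18.\<close>
  also have "\<dots> \<le> (\<Sum>j\<le>m. exp (1 / 18))"
  proof (rule sum_mono)
    fix j assume "j \<in> {..m}"
    hence "\<bar>real m / 2 - real j\<bar> \<le> real m / 2" by (auto simp: abs_if)
    hence "\<bar>t * (real m / 2 - real j)\<bar> \<le> t * (real m / 2)"
      using t by (simp add: abs_mult)
    hence "\<bar>t * (real m / 2 - real j)\<bar> \<le> 1 / 3" using t by simp
    hence "\<bar>t * (real m / 2 - real j)\<bar>\<^sup>2 \<le> (1 / 3)\<^sup>2"
      by (intro power_mono) auto
    also have "(1 / 3)\<^sup>2 = (1 / 9 :: real)" by (simp add: power2_eq_square)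
    finally have "(t * (real m / 2 - real j))\<^sup>2 / 2 \<le> 1 / 18"
      unfolding power2_abs by linarith
    hence "exp ((t * (real m / 2 - real j))\<^sup>2 / 2) \<le> exp (1 / 18)" by simp
    with cosh_le_exp_half_square show "cosh (t * (real m / 2 - real j)) \<le> exp (1 / 18)"
      by (rule order_trans)
  qed
  finally have E: "(\<Sum>j\<le>m. E j) \<le> real (m + 1) * exp (1 / 18)" by simp
  \<comment> \<open>Moving the centre from \<open>m / 2\<close> to the cutoff \<open>m / 3\<close>
    costs the factor \<open>exp (- t * m / 6)\<close>, and \<open>t * m = 2 / 3\<close>.\<close>
  have shift: "exp (t * (real m / 3 - real j)) = exp (- 1 / 9) * E j" for j
    using t by (simp add: E_def field_simps flip: exp_add)
  have "real (card (low_degree_exponents n m)) = (\<Sum>a\<in>low_degree_exponents n m. 1)" by simp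
  also have "\<dots> \<le> (\<Sum>a\<in>low_degree_exponents n m. \<Prod>i<n. exp (t * (real m / 3 - real (a i))))"
  proof (rule sum_mono)
    fix a assume "a \<in> low_degree_exponents n m"
    hence "real (3 * (\<Sum>i<n. a i)) \<le> real (n * m)"
      unfolding low_degree_exponents_def of_nat_le_iff by simp
    hence "0 \<le> (\<Sum>i<n. real m / 3 - real (a i))"
      by (simp add: sum_subtractf)
    hence "0 \<le> (\<Sum>i<n. t * (real m / 3 - real (a i)))"
      using t by (simp flip: sum_distrib_left)
    thus "1 \<le> (\<Prod>i<n. exp (t * (real m / 3 - real (a i))))"
      by (simp flip: exp_sum)
  qed
  \<comment> \<open>All weights are positive, so the sum may be extended to the full box, where it
    factors over the coordinates.\<close>
  also have "\<dots> \<le> (\<Sum>a\<in>{..<n} \<rightarrow>\<^sub>E {..m}. \<Prod>i<n. exp (t * (real m / 3 - real (a i))))"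
    by (intro sum_mono2 finite_PiE prod_nonneg) (auto simp: low_degree_exponents_def)
  also have "\<dots> = (\<Sum>j\<le>m. exp (t * (real m / 3 - real j))) ^ n"
    by (subst prod_sum_PiE[symmetric]) auto
  also have "\<dots> = (exp (- 1 / 9) * (\<Sum>j\<le>m. E j)) ^ n"
    unfolding shift by (simp add: sum_distrib_left)
  also have "\<dots> \<le> (exp (- 1 / 9) * (real (m + 1) * exp (1 / 18))) ^ n"
    by (intro power_mono mult_left_mono E mult_nonneg_nonneg sum_nonneg) (auto simp: E_def)
  also have "exp (- 1 / 9) * (real (m + 1) * exp (1 / 18)) = real (m + 1) * exp (- 1 / 18 :: real)"
    by (simp flip: exp_add)
  finally show ?thesis .
qed

section \<open>Sorting monomials into slices\<close>

text \<open>The binomial theorem is applied twice. The index \<open>None\<close> carries the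
  constant 1, and \<open>Some (a, b)\<close> the term with exponents \<open>a\<close>,
  \<open>b\<close> and \<open>m - a - b\<close>; later only the degree bound matters.\<close>

lemma trinomial_expansion:
  obtains T :: "(nat \<times> nat) option set" and \<alpha> \<beta> \<gamma> :: "_ \<Rightarrow> nat" and q :: "_ \<Rightarrow> int"
  where "finite T" "\<And>t. t \<in> T \<Longrightarrow> \<alpha> t + \<beta> t + \<gamma> t \<le> m"
    "\<And>x y z. 1 - (x + y - 2 * z) ^ m = (\<Sum>t\<in>T. q t * x ^ \<alpha> t * y ^ \<beta> t * z ^ \<gamma> t)"
proof -
  define P where "P = Sigma {..m} (\<lambda>a. {..m - a})"
  define T where "T = insert None (Some ` P)"
  define \<alpha> :: "(nat \<times> nat) option \<Rightarrow> nat" where "\<alpha> = case_option 0 fst"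
  define \<beta> :: "(nat \<times> nat) option \<Rightarrow> nat" where "\<beta> = case_option 0 snd"
  define \<gamma> :: "(nat \<times> nat) option \<Rightarrow> nat" where "\<gamma> = case_option 0 (\<lambda>(a, b). m - a - b)"
  define q :: "(nat \<times> nat) option \<Rightarrow> int" where
    "q = case_option 1 (\<lambda>(a, b). - (of_nat (m choose a) * of_nat ((m - a) choose b) * (- 2) ^ (m - a - b)))"
  have fin: "finite P" by (simp add: P_def)
  show thesis
  proof (rule that[of T \<alpha> \<beta> \<gamma> q])
    show "finite T" using fin by (simp add: T_def)
    show "\<alpha> t + \<beta> t + \<gamma> t \<le> m" if "t \<in> T" for t
      using that by (auto simp: T_def P_def \<alpha>_def \<beta>_def \<gamma>_def)
    fix x y z :: int
    have "(x + y - 2 * z) ^ m = (x + (y + (- 2) * z)) ^ m" by (simp add: algebra_simps)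
    also have "\<dots> = (\<Sum>a\<le>m. of_nat (m choose a) * x ^ a *
        (\<Sum>b\<le>m - a. of_nat ((m - a) choose b) * y ^ b * ((- 2) ^ (m - a - b) * z ^ (m - a - b))))"
      unfolding binomial_ring power_mult_distrib ..
    also have "\<dots> = (\<Sum>(a, b)\<in>P. of_nat (m choose a) * x ^ a *
        (of_nat ((m - a) choose b) * y ^ b * ((- 2) ^ (m - a - b) * z ^ (m - a - b))))"
      by (simp add: sum_distrib_left sum.Sigma P_def)
    also have "\<dots> = - (\<Sum>t\<in>Some ` P. q t * x ^ \<alpha> t * y ^ \<beta> t * z ^ \<gamma> t)"
      by (subst sum.reindex)
         (auto simp: q_def \<alpha>_def \<beta>_def \<gamma>_def mult_ac case_prod_unfold
               simp flip: sum_negf intro!: sum.cong)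
    finally show "1 - (x + y - 2 * z) ^ m = (\<Sum>t\<in>T. q t * x ^ \<alpha> t * y ^ \<beta> t * z ^ \<gamma> t)"
      using fin by (simp add: T_def q_def \<alpha>_def \<beta>_def \<gamma>_def)
  qed
qed

text \<open>
  Every monomial of the product has total degree at most \<open>n m\<close>, so in at least one of the three
  groups of variables its degree is at most \<open>n m / 3\<close>.
\<close>
lemma slice_decomposition:
  obtains F G H :: "(nat \<Rightarrow> nat) \<Rightarrow> (nat \<Rightarrow> int) \<Rightarrow> (nat \<Rightarrow> int) \<Rightarrow> int"
  where "\<And>x y z. (\<Prod>i<n. 1 - (x i + y i - 2 * z i) ^ m) =
      (\<Sum>a\<in>low_degree_exponents n m. (\<Prod>i<n. x i ^ a i) * F a y z)
    + (\<Sum>a\<in>low_degree_exponents n m. (\<Prod>i<n. y i ^ a i) * G a x z)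
    + (\<Sum>a\<in>low_degree_exponents n m. (\<Prod>i<n. z i ^ a i) * H a x y)"
proof -
  let ?L = "low_degree_exponents n m"
  obtain T :: "(nat \<times> nat) option set" and \<alpha> \<beta> \<gamma> :: "_ \<Rightarrow> nat" and q :: "_ \<Rightarrow> int"
    where T: "finite T" "\<And>t. t \<in> T \<Longrightarrow> \<alpha> t + \<beta> t + \<gamma> t \<le> m"
    and expand: "\<And>x y z. 1 - (x + y - 2 * z) ^ m = (\<Sum>t\<in>T. q t * x ^ \<alpha> t * y ^ \<beta> t * z ^ \<gamma> t)"
    using trinomial_expansion[of m] by blast
  define S where "S = {..<n} \<rightarrow>\<^sub>E T"
  have finS: "finite S" unfolding S_def using T by (intro finite_PiE) auto
  define low where "low \<delta> s \<longleftrightarrow> 3 * (\<Sum>i<n. \<delta> (s i)) \<le> n * m"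
    for \<delta> :: "(nat \<times> nat) option \<Rightarrow> nat" and s :: "nat \<Rightarrow> (nat \<times> nat) option"
  \<comment> \<open>Each monomial is assigned to the first group of variables in which its degree is
    low, so that none is counted twice.\<close>
  define S1 where "S1 = {s\<in>S. low \<alpha> s}"
  define S2 where "S2 = {s\<in>S. \<not> low \<alpha> s \<and> low \<beta> s}"
  define S3 where "S3 = {s\<in>S. \<not> low \<alpha> s \<and> \<not> low \<beta> s}"
  have S3: "low \<gamma> s" if "s \<in> S3" for s
  proof -
    \<comment> \<open>If the degrees in \<open>x\<close> and \<open>y\<close> both exceed
      \<open>n * m / 3\<close>, less than a third of the total degree bound remains for
      \<open>z\<close>.\<close>
    have "(\<Sum>i<n. \<alpha> (s i) + \<beta> (s i) + \<gamma> (s i)) \<le> (\<Sum>i<n. m)"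
      using that T by (intro sum_mono) (auto simp: S3_def S_def)
    thus ?thesis using that by (auto simp: sum.distrib low_def S3_def)
  qed
  have S_eq: "S = S1 \<union> S2 \<union> S3" by (auto simp: S1_def S2_def S3_def)
  have S_disj: "(S1 \<union> S2) \<inter> S3 = {}" "S1 \<inter> S2 = {}" by (auto simp: S1_def S2_def S3_def)
  have finS': "finite S1" "finite S2" "finite S3"
    using finS by (auto simp: S1_def S2_def S3_def)
  \<comment> \<open>Monomials sharing the exponent vector \<open>a\<close> in the chosen variables
    are collected into one slice; the restriction to \<open>{..<n}\<close> makes that vector
    extensional, as membership in \<open>?L\<close> requires.\<close>
  have group: "(\<Sum>s\<in>S'. (\<Prod>i<n. x i ^ \<delta> (s i)) * R s)
      = (\<Sum>a\<in>?L. (\<Prod>i<n. x i ^ a i) * (\<Sum>s | s \<in> S' \<and> (\<lambda>i\<in>{..<n}. \<delta> (s i)) = a. R s))"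
    if S': "S' \<subseteq> S" "\<And>s. s \<in> S' \<Longrightarrow> low \<delta> s" and le: "\<And>t. t \<in> T \<Longrightarrow> \<delta> t \<le> m"
    for S' \<delta> R and x :: "nat \<Rightarrow> int"
  proof -
    have "finite S'" using S' finS finite_subset by auto
    have "(\<Sum>s\<in>S'. (\<Prod>i<n. x i ^ \<delta> (s i)) * R s) =
        (\<Sum>a\<in>?L. \<Sum>s | s \<in> S' \<and> (\<lambda>i\<in>{..<n}. \<delta> (s i)) = a. (\<Prod>i<n. x i ^ \<delta> (s i)) * R s)"
    proof (rule sum.group[symmetric])
      show "(\<lambda>s. \<lambda>i\<in>{..<n}. \<delta> (s i)) ` S' \<subseteq> ?L"
        using S' le by (fastforce simp: low_degree_exponents_def low_def S_def)
    qed (use \<open>finite S'\<close> finite_low_degree_exponents in auto)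
    also have "\<dots> = (\<Sum>a\<in>?L. (\<Prod>i<n. x i ^ a i) * (\<Sum>s | s \<in> S' \<and> (\<lambda>i\<in>{..<n}. \<delta> (s i)) = a. R s))"
      unfolding sum_distrib_left by (intro sum.cong) (auto intro!: prod.cong)
    finally show ?thesis .
  qed
  define F where "F a y z = (\<Sum>s | s \<in> S1 \<and> (\<lambda>i\<in>{..<n}. \<alpha> (s i)) = a.
    \<Prod>i<n. q (s i) * y i ^ \<beta> (s i) * z i ^ \<gamma> (s i))" for a and y z :: "nat \<Rightarrow> int"
  define G where "G a x z = (\<Sum>s | s \<in> S2 \<and> (\<lambda>i\<in>{..<n}. \<beta> (s i)) = a.
    \<Prod>i<n. q (s i) * x i ^ \<alpha> (s i) * z i ^ \<gamma> (s i))" for a and x z :: "nat \<Rightarrow> int"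
  define H where "H a x y = (\<Sum>s | s \<in> S3 \<and> (\<lambda>i\<in>{..<n}. \<gamma> (s i)) = a.
    \<Prod>i<n. q (s i) * x i ^ \<alpha> (s i) * y i ^ \<beta> (s i))" for a and x y :: "nat \<Rightarrow> int"
  show thesis
  proof (rule that[of F G H])
    fix x y z :: "nat \<Rightarrow> int"
    define mon where "mon s = (\<Prod>i<n. q (s i) * x i ^ \<alpha> (s i) * y i ^ \<beta> (s i) * z i ^ \<gamma> (s i))" for s
    \<comment> \<open>Multiplying out picks one term \<open>s i\<close> of the trinomial expansion
      for each coordinate \<open>i\<close>.\<close>
    have "(\<Prod>i<n. 1 - (x i + y i - 2 * z i) ^ m) = (\<Sum>s\<in>S. mon s)"
      unfolding expand S_def mon_def using T by (subst prod_sum_PiE) auto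
    also have "\<dots> = (\<Sum>s\<in>S1. mon s) + (\<Sum>s\<in>S2. mon s) + (\<Sum>s\<in>S3. mon s)"
      unfolding S_eq using finS' S_disj by (simp add: sum.union_disjoint)
    also have "(\<Sum>s\<in>S1. mon s) = (\<Sum>s\<in>S1. (\<Prod>i<n. x i ^ \<alpha> (s i)) *
        (\<Prod>i<n. q (s i) * y i ^ \<beta> (s i) * z i ^ \<gamma> (s i)))"
      by (simp add: mon_def prod.distrib mult_ac)
    also have "\<dots> = (\<Sum>a\<in>?L. (\<Prod>i<n. x i ^ a i) * F a y z)"
      unfolding F_def using T(2) by (intro group) (auto simp: S1_def dest: T(2))
    also have "(\<Sum>s\<in>S2. mon s) = (\<Sum>s\<in>S2. (\<Prod>i<n. y i ^ \<beta> (s i)) *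
        (\<Prod>i<n. q (s i) * x i ^ \<alpha> (s i) * z i ^ \<gamma> (s i)))"
      by (simp add: mon_def prod.distrib mult_ac)
    also have "\<dots> = (\<Sum>a\<in>?L. (\<Prod>i<n. y i ^ a i) * G a x z)"
      unfolding G_def by (intro group) (auto simp: S2_def dest: T(2))
    also have "(\<Sum>s\<in>S3. mon s) = (\<Sum>s\<in>S3. (\<Prod>i<n. z i ^ \<gamma> (s i)) *
        (\<Prod>i<n. q (s i) * x i ^ \<alpha> (s i) * y i ^ \<beta> (s i)))"
      by (simp add: mon_def prod.distrib mult_ac)
    also have "\<dots> = (\<Sum>a\<in>?L. (\<Prod>i<n. z i ^ a i) * H a x y)"
      unfolding H_def using S3 by (intro group) (auto simp: S3_def dest: T(2))
    finally show "(\<Prod>i<n. 1 - (x i + y i - 2 * z i) ^ m) =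
        (\<Sum>a\<in>?L. (\<Prod>i<n. x i ^ a i) * F a y z) + (\<Sum>a\<in>?L. (\<Prod>i<n. y i ^ a i) * G a x z)
      + (\<Sum>a\<in>?L. (\<Prod>i<n. z i ^ a i) * H a x y)" .
  qed
qed

section \<open>The indicator polynomial on a progression-free set\<close>

lemma fermat_theorem_int:
  fixes p :: nat and u :: int
  assumes "prime p" "\<not> int p dvd u"
  shows "[u ^ (p - 1) = 1] (mod int p)"
proof -
  \<comment> \<open>The nonnegative residue of \<open>u\<close> carries the claim over to the
    natural numbers.\<close>
  define v where "v = nat (u mod int p)"
  have p: "p > 0" using assms(1) by (rule prime_gt_0_nat)
  hence v: "int v = u mod int p" by (simp add: v_def)
  have "\<not> p dvd v"
    using assms(2) unfolding int_dvd_int_iff[symmetric] v by (simp add: dvd_mod_iff)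
  hence "[v ^ (p - 1) = 1] (mod p)"
    by (rule fermat_theorem[OF assms(1)])
  hence "[int (v ^ (p - 1)) = int 1] (mod int p)"
    by (simp only: cong_int_iff)
  thus ?thesis by (simp add: v cong_def power_mod)
qed

text \<open>The divisibilities say that \<open>x + y = 2z\<close> in the group, so two of the three
  points coincide. Since 2 is invertible modulo the odd prime, the third coincides with
  them.\<close>

lemma progression_freeD:
  assumes p: "prime p" "odd p"
    and A: "progression_free (prime_field_vectors p n) A"
    and xyz: "x \<in> A" "y \<in> A" "z \<in> A"
    and dvd: "\<And>i. i < n \<Longrightarrow> int p dvd x i + y i - 2 * z i"
  shows "x = y \<and> y = z"
proof -
  have carrier: "A \<subseteq> {..<n} \<rightarrow>\<^sub>E {0..int p - 1}"
    using A by (simp add: progression_free_def prime_field_vectors_def residue_ring_def)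
  have eq: "u = v" if uv: "u \<in> A" "v \<in> A" and d: "\<And>i. i < n \<Longrightarrow> int p dvd 2 * (u i - v i)" for u v
  proof (rule PiE_ext)
    show "u \<in> {..<n} \<rightarrow>\<^sub>E {0..int p - 1}" "v \<in> {..<n} \<rightarrow>\<^sub>E {0..int p - 1}"
      using uv carrier by blast+
    fix i assume i: "i \<in> {..<n}"
    have "coprime (int p) 2" using p by simp
    hence "int p dvd u i - v i"
      using d[of i] i coprime_dvd_mult_right_iff[of "int p" 2 "u i - v i"] by blast
    hence "u i mod int p = v i mod int p" by (simp add: mod_eq_dvd_iff)
    moreover have "u i \<in> {0..int p - 1}" "v i \<in> {0..int p - 1}"
      using PiE_mem[OF subsetD[OF carrier] i] uv by auto
    ultimately show "u i = v i" by simp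
  qed
  have mod_eq: "2 * z i mod int p = (x i + y i) mod int p" if "i < n" for i
  proof -
    have "(x i + y i) mod int p = 2 * z i mod int p"
      using dvd[OF that] unfolding mod_eq_dvd_iff .
    thus ?thesis ..
  qed
  have "x \<otimes>\<^bsub>prime_field_vectors p n\<^esub> y = z [^]\<^bsub>prime_field_vectors p n\<^esub> (2::nat)"
  proof -
    interpret comm_group "prime_field_vectors p n"
      using p by (intro comm_group_prime_field_vectors)
    have "z \<in> carrier (prime_field_vectors p n)"
      using xyz A by (auto simp: progression_free_def)
    hence "z [^]\<^bsub>prime_field_vectors p n\<^esub> (2::nat) = z \<otimes>\<^bsub>prime_field_vectors p n\<^esub> z"
      by (simp add: numeral_2_eq_2)
    also have "\<dots> = x \<otimes>\<^bsub>prime_field_vectors p n\<^esub> y"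
      by (auto simp: prime_field_vectors_def residue_ring_def mod_eq intro!: restrict_ext)
    finally show ?thesis ..
  qed
  hence "x = y \<or> x = z \<or> y = z"
    using A xyz unfolding progression_free_def by blast
  thus ?thesis
  proof (elim disjE)
    assume "x = y" thus ?thesis using eq[of x z] dvd xyz by (simp add: algebra_simps)
  next
    assume "x = z"
    have "y = z"
    proof (rule eq)
      \<comment> \<open>With \<open>x = z\<close> the assumption already reads
        \<open>p dvd y i - z i\<close>; the factor 2 only matches the form of
        \<open>eq\<close>.\<close>
      show "int p dvd 2 * (y i - z i)" if "i < n" for i
        using dvd[OF that] \<open>x = z\<close> by (intro dvd_mult) simp
    qed (use xyz in auto)
    thus ?thesis using \<open>x = z\<close> by simp
  next
    assume "y = z"
    have "x = z"
    proof (rule eq)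
      show "int p dvd 2 * (x i - z i)" if "i < n" for i
        using dvd[OF that] \<open>y = z\<close> by (intro dvd_mult) simp
    qed (use xyz in auto)
    thus ?thesis using \<open>y = z\<close> by simp
  qed
qed

text \<open>Off the diagonal of \<open>A\<close> some coordinate of \<open>x + y - 2z\<close> is
  nonzero modulo p, and by Fermat its factor vanishes; on the diagonal every factor is 1. The slice
  decomposition therefore represents the diagonal tensor.\<close>

lemma card_progression_free_le:
  assumes p: "prime p" "odd p"
    and A: "progression_free (prime_field_vectors p n) A"
  shows "card A \<le> 3 * card (low_degree_exponents n (p - 1))"
proof -
  let ?L = "low_degree_exponents n (p - 1)"
  obtain F G H :: "(nat \<Rightarrow> nat) \<Rightarrow> (nat \<Rightarrow> int) \<Rightarrow> (nat \<Rightarrow> int) \<Rightarrow> int"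
    where FGH: "\<And>x y z. (\<Prod>i<n. 1 - (x i + y i - 2 * z i) ^ (p - 1)) =
        (\<Sum>a\<in>?L. (\<Prod>i<n. x i ^ a i) * F a y z) + (\<Sum>a\<in>?L. (\<Prod>i<n. y i ^ a i) * G a x z)
      + (\<Sum>a\<in>?L. (\<Prod>i<n. z i ^ a i) * H a x y)"
    using slice_decomposition[of "p - 1" n] by blast
  have "A \<subseteq> {..<n} \<rightarrow>\<^sub>E {0..int p - 1}"
    using A by (simp add: progression_free_def prime_field_vectors_def residue_ring_def)
  hence finA: "finite A" by (rule finite_subset) (intro finite_PiE, auto)
  have "card A \<le> card ?L + card ?L + card ?L"
  proof (rule slice_rank_diagonal[OF p(1) finA finite_low_degree_exponents
        finite_low_degree_exponents finite_low_degree_exponents])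
    fix x y z assume xyz: "x \<in> A" "y \<in> A" "z \<in> A"
    have "[(\<Prod>i<n. 1 - (x i + y i - 2 * z i) ^ (p - 1)) = (if x = y \<and> y = z then 1 else 0)] (mod int p)"
    proof (cases "x = y \<and> y = z")
      case True
      \<comment> \<open>A positive exponent is what makes \<open>0 ^ (p - 1)\<close> vanish, so that
        each factor equals 1.\<close>
      moreover have "p - 1 > 0" using prime_gt_1_nat[OF p(1)] by simp
      ultimately show ?thesis by (simp add: zero_power)
    next
      case False
      then obtain i where i: "i < n" "\<not> int p dvd x i + y i - 2 * z i"
        using progression_freeD[OF p A xyz] by blast
      have "int p dvd 1 - (x i + y i - 2 * z i) ^ (p - 1)"
        using cong_sym[OF fermat_theorem_int[OF p(1) i(2)]] by (simp add: cong_iff_dvd_diff)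
      also have "\<dots> dvd (\<Prod>i<n. 1 - (x i + y i - 2 * z i) ^ (p - 1))"
        using i by (intro dvd_prodI) auto
      finally show ?thesis using False by (auto simp: cong_0_iff)
    qed
    thus "[(\<Sum>a\<in>?L. (\<Prod>i<n. x i ^ a i) * F a y z) + (\<Sum>a\<in>?L. (\<Prod>i<n. y i ^ a i) * G a x z)
      + (\<Sum>a\<in>?L. (\<Prod>i<n. z i ^ a i) * H a x y) = (if x = y \<and> y = z then 1 else 0)] (mod int p)"
      unfolding FGH .
  qed
  thus ?thesis by simp
qed

section \<open>Passing to the exponent \<open>c\<close>\<close>

theorem theorem2:
  fixes p :: nat and c :: real
  assumes "Factorial_Ring.prime p" and "odd p"
    and "c = 1 - 1 / (18 * ln (real p))"
  shows "c < 1 \<and>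
    (\<exists>K::real. K > 0 \<and>
      (\<forall>n::nat. n > 0 \<longrightarrow> (\<forall>A. progression_free (prime_field_vectors p n) A \<longrightarrow>
         real (card A) \<le> K * real p powr (c * real n))))"
proof
  have p: "p > 1" using assms(1) by (rule prime_gt_1_nat)
  hence ln: "ln (real p) > 0" by simp
  thus "c < 1" using assms(3) by simp
  \<comment> \<open>This is the choice of \<open>c\<close>: the Chernoff base
    \<open>p * exp (- 1 / 18)\<close> is exactly \<open>p powr c\<close>.\<close>
  have exponent: "ln (real p) * c = ln (real p) + (- 1 / 18)"
    using ln by (simp add: assms(3) right_diff_distrib)
  \<comment> \<open>The constant 3 counts the groups of variables \<open>x\<close>,
    \<open>y\<close>, \<open>z\<close>.\<close>
  have "real (card A) \<le> 3 * real p powr (c * real n)"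
    if A: "progression_free (prime_field_vectors p n) A" for n A
  proof -
    have "real (card A) \<le> 3 * real (card (low_degree_exponents n (p - 1)))"
      using card_progression_free_le[OF assms(1,2) A] by linarith
    also have "\<dots> \<le> 3 * (real (p - 1 + 1) * exp (- 1 / 18)) ^ n"
      using p by (intro mult_left_mono card_low_degree_exponents) auto
    also have "real (p - 1 + 1) * exp (- 1 / 18 :: real) = exp (ln (real p) * c)"
      unfolding exponent exp_add using p by simp
    also have "exp (ln (real p) * c) ^ n = real p powr (c * real n)"
      using p by (simp add: powr_def mult_ac flip: exp_of_nat_mult)
    finally show ?thesis .
  qed
  thus "\<exists>K::real. K > 0 \<and>
      (\<forall>n::nat. n > 0 \<longrightarrow> (\<forall>A. progression_free (prime_field_vectors p n) A \<longrightarrow>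
         real (card A) \<le> K * real p powr (c * real n)))"
    by (intro exI[of _ 3]) auto
qed

end
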